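(* Let $G=(V,E)$ be an undirected graph with nonnegative edge weights $w(e)$, let $k\ge 1$, and let $\ell:V\to\{0,1,\dots,k\}$ be vertex priorities, with $T_i=\{v\in V:\ell(v)\ge i\}$. Fix one of the sparsification types described in the context (Steiner tree, subset multiplicative $\alpha$-spanner, subset additive $+\beta$ spanner, or subset distance preserver), and let $\mathcal{F}(T)$ denote the set of valid sparsifications of $G$ over a terminal set $T$. Suppose we are given an oracle that, for any terminal set $T$, returns a minimum-weight element of $\mathcal{F}(T)$. Then, with at most $\log_2 k+1$ queries to the oracle, the $k$-priority approximation algorithm described in the context computes a $k$-priority sparsification $H$ of $(G,\ell)$ with $\mathrm{weight}(H)\le 4\,\mathrm{weight}(\mathrm{OPT})$, where $\mathrm{OPT}$ is a minimum-weight $k$-priority sparsification of $(G,\ell)$.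
   Context: Valid sparsifications: for a terminal set $T\subseteq V$, a valid sparsification is a subgraph $H$ of $G$ containing all of $T$ in one connected component and satisfying the type-specific constraint: (Steiner tree) $H$ is a tree spanning $T$; (subset multiplicative $\alpha$-spanner) $d_H(u,v)\le \alpha\, d_G(u,v)$ for all $u,v\in T$; (subset additive $+\beta$ spanner) $d_H(u,v)\le d_G(u,v)+\beta$ for all $u,v\in T$; (subset distance preserver) $d_H(u,v)=d_G(u,v)$ for all $u,v\in T$. Here $d_X$ is the shortest-path distance in $X$. It is assumed that for $i<j$ and $H_i\in\mathcal{F}(T_i)$, $H_j\in\mathcal{F}(T_j)$ there is $H_{i,j}\in\mathcal{F}(T_i)$ with $H_j\subseteq H_{i,j}\subseteq H_i\cup H_j$. $k$-priority sparsification: a subgraph $H$ of $G$ with edge rates $R:E(H)\to\{1,\dots,k\}$ such that for every $i\in\{1,\dots,k\}$ the subgraph of $H$ formed by the edges of rate $\ge i$ belongs to $\mathcal{F}(T_i)$. Its weight is $\mathrm{weight}(H)=\sum_{e\in E(H)} R(e)\,w(e)$ (i.e. an edge of rate $r$ costs $r\,w(e)$, "linear edge weights"). The $k$-priority approximation algorithm: (1) round up the priority of every vertex with positive priority to the nearest power of $2$; (2) partition the rounded-up terminals into sets $S_i$, one for each rounded priority $i$, either inclusively ($S_i$ = set of vertices of rounded priority $\ge i$) or pairwise ($S_i$ = set of terminal pairs $\{u,v\}$ whose minimum rounded priority equals $i$); (3) for each $S_i$ compute independently (with the oracle) a minimum-weight single-priority sparsification $H_i$ satisfying the constraints for $S_i$;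 (4) for $i$ from the highest level down to $1$, merge the solution of higher levels into lower levels: every edge present in $H_j$ with $j>i$ is added to $H_i$, and in the Steiner tree case lower-rated edges are pruned so that no cycle remains. Each edge receives as rate the largest level $i$ at which it is present.
   Formalization: The query bound is proved as ⌈log₂ k⌉+1, since log₂ k+1 fails when k is not a power of 2 (k=3 with priorities 1,2,3 needs 3 queries); edges present at a rounded level above k receive rate k, since rates must lie in {1,…,k}. *)

theory Defs
  imports Complex_Main "HOL-Library.Extended_Real"
begin

text \<open>
  A finite undirected graph is given by its vertex set \<open>V\<close> and a set \<open>E\<close> of two-element subsets
  of \<open>V\<close>.  A subgraph is given by its edge set \<open>F \<subseteq> E\<close>: as a sparsification over terminals \<open>T\<close>
  it stands for the subgraph with vertex set \<open>T \<union> \<Union>F\<close>.  Isolated non-terminals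
  carry no weight and no constraint, and a single terminal needs no edge.
\<close>

definition ugraph :: "'a set \<Rightarrow> 'a set set \<Rightarrow> bool" where
  "ugraph V E \<longleftrightarrow> finite V \<and> (\<forall>e\<in>E. e \<subseteq> V \<and> card e = 2)"

definition edge_weight :: "('a set \<Rightarrow> real) \<Rightarrow> 'a set set \<Rightarrow> real" where
  "edge_weight w F = (\<Sum>e\<in>F. w e)"


subsection \<open>Walks, distance, trees\<close>

fun walk_edges :: "'a list \<Rightarrow> 'a set list" where
  "walk_edges (u # v # p) = {u, v} # walk_edges (v # p)"
| "walk_edges p = []"

definition walk_betw :: "'a set set \<Rightarrow> 'a \<Rightarrow> 'a list \<Rightarrow> 'a \<Rightarrow> bool" where
  "walk_betw F u p v \<longleftrightarrow> p \<noteq> [] \<and> hd p = u \<and> last p = v \<and> set (walk_edges p) \<subseteq> F"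

definition walk_weight :: "('a set \<Rightarrow> real) \<Rightarrow> 'a list \<Rightarrow> real" where
  "walk_weight w p = sum_list (map w (walk_edges p))"

text \<open>The distance is \<open>\<infinity>\<close> if there is no walk.\<close>

definition graph_dist :: "('a set \<Rightarrow> real) \<Rightarrow> 'a set set \<Rightarrow> 'a \<Rightarrow> 'a \<Rightarrow> ereal" where
  "graph_dist w F u v = (INF p \<in> {p. walk_betw F u p v}. ereal (walk_weight w p))"

definition joined :: "'a set set \<Rightarrow> 'a set \<Rightarrow> bool" where
  "joined F X \<longleftrightarrow> (\<forall>u\<in>X. \<forall>v\<in>X. \<exists>p. walk_betw F u p v)"

definition is_cycle :: "'a set set \<Rightarrow> 'a list \<Rightarrow> bool" where
  "is_cycle F c \<longleftrightarrow> 3 \<le> length c \<and> distinct c \<and> set (walk_edges (c @ [hd c])) \<subseteq> F"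

definition acyclic_edges :: "'a set set \<Rightarrow> bool" where
  "acyclic_edges F \<longleftrightarrow> (\<nexists>c. is_cycle F c)"

text \<open>The subgraph with edge set \<open>F\<close> and vertex set \<open>T \<union> \<Union>F\<close> is a tree.  The empty graph
  (\<open>T = F = {}\<close>) counts as a tree, so that levels without terminals need no edges.\<close>

definition tree_spanning :: "'a set set \<Rightarrow> 'a set \<Rightarrow> bool" where
  "tree_spanning F T \<longleftrightarrow> joined F (T \<union> \<Union>F) \<and> acyclic_edges F"


subsection \<open>Single-priority sparsifications\<close>

datatype sparsification_type =
    Steiner_Tree
  | Multiplicative_Spanner real
  | Additive_Spanner real
  | Distance_Preserver

fun distance_constraint ::
  "sparsification_type \<Rightarrow> 'a set set \<Rightarrow> ('a set \<Rightarrow> real) \<Rightarrow> 'a set set \<Rightarrow> 'a \<Rightarrow> 'a \<Rightarrow> bool" where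
  "distance_constraint Steiner_Tree E w F u v \<longleftrightarrow> True"
| "distance_constraint (Multiplicative_Spanner \<alpha>) E w F u v \<longleftrightarrow>
     graph_dist w F u v \<le> ereal \<alpha> * graph_dist w E u v"
| "distance_constraint (Additive_Spanner \<beta>) E w F u v \<longleftrightarrow>
     graph_dist w F u v \<le> graph_dist w E u v + ereal \<beta>"
| "distance_constraint Distance_Preserver E w F u v \<longleftrightarrow>
     graph_dist w F u v = graph_dist w E u v"

definition sparsifications ::
  "sparsification_type \<Rightarrow> 'a set set \<Rightarrow> ('a set \<Rightarrow> real) \<Rightarrow> 'a set \<Rightarrow> 'a set set set" where
  "sparsifications ty E w T = {F. F \<subseteq> E \<and> joined F T \<and>
     (ty = Steiner_Tree \<longrightarrow> tree_spanning F T) \<and>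
     (\<forall>u\<in>T. \<forall>v\<in>T. distance_constraint ty E w F u v)}"

text \<open>The same constraints when only the pairs in \<open>P\<close> are demanded; the terminals are
  those occurring in some pair.\<close>

definition pair_sparsifications ::
  "sparsification_type \<Rightarrow> 'a set set \<Rightarrow> ('a set \<Rightarrow> real) \<Rightarrow> 'a set set \<Rightarrow> 'a set set set" where
  "pair_sparsifications ty E w P = {F. F \<subseteq> E \<and> joined F (\<Union>P) \<and>
     (ty = Steiner_Tree \<longrightarrow> tree_spanning F (\<Union>P)) \<and>
     (\<forall>u v. {u, v} \<in> P \<longrightarrow> distance_constraint ty E w F u v)}"


subsection \<open>Multi-priority sparsifications\<close>

definition terminals :: "'a set \<Rightarrow> ('a \<Rightarrow> nat) \<Rightarrow> nat \<Rightarrow> 'a set" where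
  "terminals V \<pi> i = {v \<in> V. i \<le> \<pi> v}"

definition priority_sparsification ::
  "sparsification_type \<Rightarrow> 'a set \<Rightarrow> 'a set set \<Rightarrow> ('a set \<Rightarrow> real) \<Rightarrow> nat \<Rightarrow> ('a \<Rightarrow> nat) \<Rightarrow>
   'a set set \<Rightarrow> ('a set \<Rightarrow> nat) \<Rightarrow> bool" where
  "priority_sparsification ty V E w k \<pi> H R \<longleftrightarrow>
     H \<subseteq> E \<and> (\<forall>e\<in>H. R e \<in> {1..k}) \<and>
     (\<forall>i\<in>{1..k}. {e \<in> H. i \<le> R e} \<in> sparsifications ty E w (terminals V \<pi> i))"

definition priority_weight :: "('a set \<Rightarrow> real) \<Rightarrow> 'a set set \<Rightarrow> ('a set \<Rightarrow> nat) \<Rightarrow> real" where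
  "priority_weight w H R = (\<Sum>e\<in>H. real (R e) * w e)"

definition optimal_priority_sparsification ::
  "sparsification_type \<Rightarrow> 'a set \<Rightarrow> 'a set set \<Rightarrow> ('a set \<Rightarrow> real) \<Rightarrow> nat \<Rightarrow> ('a \<Rightarrow> nat) \<Rightarrow>
   'a set set \<Rightarrow> ('a set \<Rightarrow> nat) \<Rightarrow> bool" where
  "optimal_priority_sparsification ty V E w k \<pi> H R \<longleftrightarrow>
     priority_sparsification ty V E w k \<pi> H R \<and>
     (\<forall>H' R'. priority_sparsification ty V E w k \<pi> H' R' \<longrightarrow>
        priority_weight w H R \<le> priority_weight w H' R')"


subsection \<open>The single-priority solver\<close>

datatype partition_mode = Inclusive | Pairwise

datatype 'a query = Terminals "'a set" | Pairs "'a set set"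

fun solutions ::
  "sparsification_type \<Rightarrow> 'a set set \<Rightarrow> ('a set \<Rightarrow> real) \<Rightarrow> 'a query \<Rightarrow> 'a set set set" where
  "solutions ty E w (Terminals T) = sparsifications ty E w T"
| "solutions ty E w (Pairs P) = pair_sparsifications ty E w P"

fun admissible_queries :: "partition_mode \<Rightarrow> 'a set \<Rightarrow> 'a query set" where
  "admissible_queries Inclusive V = {Terminals T | T. T \<subseteq> V}"
| "admissible_queries Pairwise V = {Pairs P | P. \<forall>p\<in>P. p \<subseteq> V \<and> card p = 2}"

text \<open>Nothing is required of the answer to an infeasible query.\<close>

definition min_weight_solver ::
  "sparsification_type \<Rightarrow> partition_mode \<Rightarrow> 'a set \<Rightarrow> 'a set set \<Rightarrow> ('a set \<Rightarrow> real) \<Rightarrow>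
   ('a query \<Rightarrow> 'a set set) \<Rightarrow> bool" where
  "min_weight_solver ty mode V E w slv \<longleftrightarrow>
     (\<forall>q \<in> admissible_queries mode V. solutions ty E w q \<noteq> {} \<longrightarrow>
        slv q \<in> solutions ty E w q \<and>
        (\<forall>F \<in> solutions ty E w q. edge_weight w (slv q) \<le> edge_weight w F))"


subsection \<open>The approximation algorithm\<close>

definition round_up :: "nat \<Rightarrow> nat" where
  "round_up n = (if n = 0 then 0 else 2 ^ (LEAST q. n \<le> 2 ^ q))"

fun part :: "partition_mode \<Rightarrow> 'a set \<Rightarrow> ('a \<Rightarrow> nat) \<Rightarrow> nat \<Rightarrow> 'a query" where
  "part Inclusive V \<pi> i = Terminals {v \<in> V. i \<le> round_up (\<pi> v)}"
| "part Pairwise V \<pi> i =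
     Pairs {{u, v} | u v. u \<in> V \<and> v \<in> V \<and> u \<noteq> v \<and> min (round_up (\<pi> u)) (round_up (\<pi> v)) = i}"

text \<open>One level for each rounded positive priority that occurs, except that there is no query
  for an empty block (a pairwise block is empty if a single vertex has the highest priority).\<close>

definition levels :: "partition_mode \<Rightarrow> 'a set \<Rightarrow> ('a \<Rightarrow> nat) \<Rightarrow> nat set" where
  "levels mode V \<pi> = {i \<in> (\<lambda>v. round_up (\<pi> v)) ` V.
     0 < i \<and> part mode V \<pi> i \<noteq> Terminals {} \<and> part mode V \<pi> i \<noteq> Pairs {}}"

text \<open>Delete an edge on a cycle of \<open>A\<close>, keeping the edges \<open>K\<close> of higher levels.\<close>

definition prune_step :: "'a set set \<Rightarrow> 'a set set \<Rightarrow> 'a set set \<Rightarrow> bool" where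
  "prune_step K A B \<longleftrightarrow>
     (\<exists>e c. e \<in> A - K \<and> is_cycle A c \<and> e \<in> set (walk_edges (c @ [hd c])) \<and> B = A - {e})"

definition merge_result ::
  "sparsification_type \<Rightarrow> 'a set set \<Rightarrow> 'a set set \<Rightarrow> 'a set set \<Rightarrow> bool" where
  "merge_result ty F K M \<longleftrightarrow>
     (if ty = Steiner_Tree then (prune_step K)\<^sup>*\<^sup>* (F \<union> K) M \<and> acyclic_edges M else M = F \<union> K)"

text \<open>
  \<open>priority_run ty mode V k \<pi> slv qs H R\<close>: a run of the algorithm asks \<open>slv\<close> the queries \<open>qs\<close>
  and returns \<open>H\<close> with rates \<open>R\<close>.  It is a relation because the pruning may choose which cycle
  edges to delete.  \<open>M i\<close> is the solution of level \<open>i\<close> after merging.  For the rates, an edge of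
  \<open>M j\<close> is present at every level \<open>i \<le> j\<close>; the levels end at \<open>k\<close>, although the largest rounded
  priority may exceed \<open>k\<close>.
\<close>

definition priority_run ::
  "sparsification_type \<Rightarrow> partition_mode \<Rightarrow> 'a set \<Rightarrow> nat \<Rightarrow> ('a \<Rightarrow> nat) \<Rightarrow>
   ('a query \<Rightarrow> 'a set set) \<Rightarrow> 'a query list \<Rightarrow> 'a set set \<Rightarrow> ('a set \<Rightarrow> nat) \<Rightarrow> bool" where
  "priority_run ty mode V k \<pi> slv qs H R \<longleftrightarrow>
     (let L = levels mode V \<pi> in
      qs = map (part mode V \<pi>) (sorted_list_of_set L) \<and>
      (\<exists>M. (\<forall>i\<in>L. merge_result ty (slv (part mode V \<pi> i)) (\<Union>j\<in>{j\<in>L. i < j}. M j) (M i)) \<and>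
           H = (\<Union>i\<in>L. M i) \<and>
           R = (\<lambda>e. Max {i \<in> {1..k}. \<exists>j\<in>L. i \<le> j \<and> e \<in> M j})))"

end

theory Submission
  imports Defs
begin

text \<open>
  Rounding loses at most a constant factor: a vertex has rounded priority at least \<open>j = 2 ^ q\<close>
  iff its priority exceeds \<open>j div 2\<close>.  So the edges of \<open>OPT\<close> of rate above \<open>j div 2\<close> answer the
  query of level \<open>j\<close>, and the solver's answer is no heavier.  An edge whose highest
  level is \<open>j\<close> was bought by the answer of level \<open>j\<close> and is rated at most \<open>j\<close>, hence the output
  costs at most the sum over \<open>j\<close> of \<open>j\<close> times the weight of that answer.  An edge of rate \<open>r\<close> in \<open>OPT\<close>
  is charged the powers of two \<open>j\<close> with \<open>j div 2 < r\<close>, whose sum is at most \<open>4 r\<close>.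
\<close>

section \<open>Walks and reachability\<close>

text \<open>Reachability is handled as the reflexive transitive closure of this relation, so that
  connections are composed and reversed by closure laws instead of by manipulating walks.\<close>

definition adjacent :: "'a set set \<Rightarrow> 'a \<Rightarrow> 'a \<Rightarrow> bool" where
  "adjacent F x y \<longleftrightarrow> {x, y} \<in> F"

lemma walk_edges_append:
  "walk_edges (xs @ a # ys) = walk_edges (xs @ [a]) @ walk_edges (a # ys)"
  by (induction xs rule: walk_edges.induct) (auto simp: neq_Nil_conv)

lemma walk_edges_split:
  "e \<in> set (walk_edges p) \<Longrightarrow> \<exists>xs a b ys. p = xs @ a # b # ys \<and> e = {a, b}"
proof (induction p rule: walk_edges.induct)
  case (1 u v p)
  show ?case
  proof (cases "e = {u, v}")
    case True
    then show ?thesis by (metis append_Nil)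
  next
    case False
    then have "e \<in> set (walk_edges (v # p))" using 1(2) by simp
    with 1(1) obtain xs a b ys where "v # p = xs @ a # b # ys" "e = {a, b}" by blast
    then show ?thesis by (metis append_Cons)
  qed
qed auto

lemma walk_edges_subset_vertices: "e \<in> set (walk_edges p) \<Longrightarrow> e \<subseteq> set p"
  by (induction p rule: walk_edges.induct) auto

lemma walk_imp_adjacent_rtranclp:
  "p \<noteq> [] \<Longrightarrow> set (walk_edges p) \<subseteq> F \<Longrightarrow> (adjacent F)\<^sup>*\<^sup>* (hd p) (last p)"
proof (induction p rule: walk_edges.induct)
  case (1 u v p)
  have "adjacent F u v" using 1(3) by (simp add: adjacent_def)
  moreover have "(adjacent F)\<^sup>*\<^sup>* v (last (v # p))" using 1 by simp
  ultimately show ?case by (simp add: converse_rtranclp_into_rtranclp)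
qed auto

lemma walk_betw_iff_rtranclp: "(\<exists>p. walk_betw F u p v) \<longleftrightarrow> (adjacent F)\<^sup>*\<^sup>* u v"
proof
  show "\<exists>p. walk_betw F u p v \<Longrightarrow> (adjacent F)\<^sup>*\<^sup>* u v"
    using walk_imp_adjacent_rtranclp by (auto simp: walk_betw_def)
next
  show "(adjacent F)\<^sup>*\<^sup>* u v \<Longrightarrow> \<exists>p. walk_betw F u p v"
  proof (induction rule: converse_rtranclp_induct)
    case base
    have "walk_betw F v [v] v" by (simp add: walk_betw_def)
    then show ?case ..
  next
    case (step y z)
    then obtain p where p: "walk_betw F z p v" by blast
    then obtain q where "p = z # q" by (cases p) (auto simp: walk_betw_def)
    then have "walk_betw F y (y # p) v"
      using p step(1) by (auto simp: walk_betw_def adjacent_def)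
    then show ?case ..
  qed
qed

lemma joined_iff_rtranclp: "joined F X \<longleftrightarrow> (\<forall>u\<in>X. \<forall>v\<in>X. (adjacent F)\<^sup>*\<^sup>* u v)"
  by (simp add: joined_def walk_betw_iff_rtranclp)

lemma adjacent_rtranclp_mono:
  assumes "F \<subseteq> F'" and "(adjacent F)\<^sup>*\<^sup>* u v"
  shows "(adjacent F')\<^sup>*\<^sup>* u v"
  using assms(2) by (rule mono_rtranclp[rule_format, rotated])
    (use assms(1) in \<open>auto simp: adjacent_def\<close>)

lemma adjacent_rtranclp_sym: "(adjacent F)\<^sup>*\<^sup>* u v \<Longrightarrow> (adjacent F)\<^sup>*\<^sup>* v u"
  by (rule sympD[OF symp_rtranclp]) (auto simp: symp_def adjacent_def insert_commute)

lemma joined_mono: "joined F X \<Longrightarrow> F \<subseteq> F' \<Longrightarrow> Y \<subseteq> X \<Longrightarrow> joined F' Y"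
  unfolding joined_iff_rtranclp using adjacent_rtranclp_mono by (metis subsetD)

lemma tree_spanning_mono: "tree_spanning F X \<Longrightarrow> Y \<subseteq> X \<Longrightarrow> tree_spanning F Y"
  unfolding tree_spanning_def by (auto intro: joined_mono)


section \<open>Deleting cycle edges\<close>

lemma acyclic_edges_empty: "acyclic_edges {}"
proof -
  have "\<not> is_cycle {} c" for c :: "'a list"
    by (cases c rule: walk_edges.cases) (auto simp: is_cycle_def)
  then show ?thesis by (simp add: acyclic_edges_def)
qed

text \<open>Both closed walks consist of the edges along \<open>xs\<close>, those along
  \<open>ys\<close> and the edges linking the two lists; only the order differs.\<close>

lemma closed_walk_edges_rotate:
  "set (walk_edges ((xs @ ys) @ [hd (xs @ ys)])) = set (walk_edges ((ys @ xs) @ [hd (ys @ xs)]))"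
proof (cases "xs = [] \<or> ys = []")
  case False
  then obtain x xs' y ys' where "xs = x # xs'" "ys = y # ys'" by (meson neq_Nil_conv)
  then show ?thesis
    using walk_edges_append[of xs y "ys' @ [x]"] walk_edges_append[of ys x "xs' @ [y]"]
    by auto
qed auto

text \<open>Turns the cycle so that the chosen edge becomes the closing one. What remains is the
  path \<open>b # zs @ [a]\<close>, the detour around that edge.\<close>

lemma cycle_edge_rotate:
  assumes "is_cycle A c" and "e \<in> set (walk_edges (c @ [hd c]))"
  obtains b zs a where "is_cycle A (b # zs @ [a])" and "e = {a, b}" and "zs \<noteq> []"
proof -
  obtain xs a b ys where *: "c @ [hd c] = xs @ a # b # ys" and e: "e = {a, b}"
    using walk_edges_split[OF assms(2)] by blast
  have c: "3 \<le> length c" "distinct c" "set (walk_edges (c @ [hd c])) \<subseteq> A"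
    using assms(1) by (auto simp: is_cycle_def)
  have "\<exists>us vs zs. c = us @ vs \<and> vs @ us = b # zs @ [a]"
  \<comment> \<open>\<open>ys = []\<close> means that \<open>e\<close> already closes
    \<open>c\<close>; otherwise \<open>c\<close> is cut between \<open>a\<close> and
    \<open>b\<close> and its two pieces are swapped.\<close>
  proof (cases ys rule: rev_cases)
    case Nil
    with * have "c @ [hd c] = (xs @ [a]) @ [b]" by (simp only: append_assoc append_Cons append_Nil)
    then have ca: "c = xs @ [a]" "hd c = b" by (blast dest: append1_eq_conv[THEN iffD1])+
    then obtain zs where "xs = b # zs" using c(1) by (cases xs) auto
    then have "c = [] @ c" "c @ [] = b # zs @ [a]" using ca by auto
    then show ?thesis by blast
  next
    case (snoc ys' y)
    with * have "c @ [hd c] = ((xs @ [a]) @ b # ys') @ [y]"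
      by (simp only: append_assoc append_Cons append_Nil)
    then have "c = (xs @ [a]) @ b # ys'" by (blast dest: append1_eq_conv[THEN iffD1])
    moreover have "(b # ys') @ (xs @ [a]) = b # (ys' @ xs) @ [a]" by simp
    ultimately show ?thesis by blast
  qed
  then obtain us vs zs where uv: "c = us @ vs" and zs: "vs @ us = b # zs @ [a]" by blast
  have "length (vs @ us) = length c" using uv by simp
  then have "zs \<noteq> []" using zs c(1) by auto
  moreover have "is_cycle A (b # zs @ [a])"
    using c closed_walk_edges_rotate[of us vs] uv
    unfolding is_cycle_def zs[symmetric] by auto
  ultimately show ?thesis using that e by blast
qed

text \<open>Every step across \<open>e\<close> can be replaced by the detour along the rest of the
  cycle.\<close>

lemma reachable_delete_cycle_edge:
  assumes "is_cycle A c" and "e \<in> set (walk_edges (c @ [hd c]))" and "(adjacent A)\<^sup>*\<^sup>* u v"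
  shows "(adjacent (A - {e}))\<^sup>*\<^sup>* u v"
proof -
  obtain b zs a where cyc: "is_cycle A (b # zs @ [a])" and e: "e = {a, b}" and zs: "zs \<noteq> []"
    using cycle_edge_rotate[OF assms(1,2)] by blast
  have dist: "distinct (b # zs @ [a])" using cyc by (simp add: is_cycle_def)
  obtain ys z where z: "zs = ys @ [z]" using zs by (cases zs rule: rev_cases) auto
  have edges: "walk_edges (b # zs @ [a]) = walk_edges (b # zs) @ [{z, a}]"
    using walk_edges_append[of "b # ys" z "[a]"] z by simp
  \<comment> \<open>The detour avoids \<open>e\<close>: no edge along \<open>b # zs\<close> touches
    \<open>a\<close>, and \<open>{z, a}\<close> differs from \<open>{a, b}\<close> because
    \<open>z\<close> lies in \<open>zs\<close> and hence is not \<open>b\<close>.\<close>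
  have "e \<notin> set (walk_edges (b # zs))"
    using walk_edges_subset_vertices[of e "b # zs"] dist e by auto
  moreover have "e \<noteq> {z, a}" using dist e z by (auto simp: doubleton_eq_iff)
  moreover have "set (walk_edges (b # zs @ [a])) \<subseteq> A"
    using cyc walk_edges_append[of "b # zs" a "[b]"] by (auto simp: is_cycle_def)
  ultimately have "set (walk_edges (b # zs @ [a])) \<subseteq> A - {e}" using edges by auto
  from walk_imp_adjacent_rtranclp[OF _ this]
  have ba: "(adjacent (A - {e}))\<^sup>*\<^sup>* b a" by simp
  have "(adjacent (A - {e}))\<^sup>*\<^sup>* x y" if "adjacent A x y" for x y
  proof (cases "{x, y} = e")
    case True
    then show ?thesis
      using ba adjacent_rtranclp_sym[OF ba] e by (auto simp: doubleton_eq_iff)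
  next
    case False
    then show ?thesis using that by (auto simp: adjacent_def)
  qed
  with assms(3) show ?thesis
    by (induction rule: rtranclp_induct) (auto intro: rtranclp_trans)
qed

lemma prune_steps_subset:
  "(prune_step K)\<^sup>*\<^sup>* A M \<Longrightarrow> M \<subseteq> A \<and> (K \<subseteq> A \<longrightarrow> K \<subseteq> M)"
  by (induction rule: rtranclp_induct) (auto simp: prune_step_def)

lemma prune_steps_reachable:
  "(prune_step K)\<^sup>*\<^sup>* A M \<Longrightarrow> (adjacent A)\<^sup>*\<^sup>* u v \<Longrightarrow> (adjacent M)\<^sup>*\<^sup>* u v"
  by (induction rule: rtranclp_induct) (auto simp: prune_step_def reachable_delete_cycle_edge)

text \<open>An acyclic \<open>K\<close> contains no cycle in full, so as long as a cycle remains,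
  one of its edges lies outside \<open>K\<close> and may be deleted. Finiteness of \<open>A\<close>
  ends the process.\<close>

lemma prune_to_acyclic:
  assumes "finite A" and "acyclic_edges K"
  shows "\<exists>M. (prune_step K)\<^sup>*\<^sup>* A M \<and> acyclic_edges M"
  using assms(1)
proof (induction A rule: finite_psubset_induct)
  case (psubset A)
  show ?case
  proof (cases "acyclic_edges A")
    case False
    then obtain c where c: "is_cycle A c" by (auto simp: acyclic_edges_def)
    have "\<not> is_cycle K c" using assms(2) by (auto simp: acyclic_edges_def)
    with c obtain e where e: "e \<in> set (walk_edges (c @ [hd c]))" "e \<notin> K" "e \<in> A"
      by (auto simp: is_cycle_def)
    with c have step: "prune_step K A (A - {e})" by (auto simp: prune_step_def)
    obtain M where "(prune_step K)\<^sup>*\<^sup>* (A - {e}) M" "acyclic_edges M"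
      using psubset.IH[of "A - {e}"] e by blast
    then show ?thesis using step by (meson converse_rtranclp_into_rtranclp)
  qed auto
qed

lemma merge_result_subset: "merge_result ty F K M \<Longrightarrow> K \<subseteq> M \<and> M \<subseteq> F \<union> K"
  using prune_steps_subset[of K "F \<union> K" M] by (auto simp: merge_result_def split: if_splits)

lemma merge_result_reachable:
  "merge_result ty F K M \<Longrightarrow> (adjacent (F \<union> K))\<^sup>*\<^sup>* u v \<Longrightarrow> (adjacent M)\<^sup>*\<^sup>* u v"
  by (auto simp: merge_result_def prune_steps_reachable split: if_splits)


section \<open>Distances\<close>

lemma graph_dist_antimono: "F \<subseteq> F' \<Longrightarrow> graph_dist w F' u v \<le> graph_dist w F u v"
  unfolding graph_dist_def by (rule INF_superset_mono) (auto simp: walk_betw_def)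

lemma graph_dist_refl:
  assumes "\<forall>e\<in>F. 0 \<le> w e"
  shows "graph_dist w F u u = 0"
proof (rule antisym)
  have "walk_betw F u [u] u" by (simp add: walk_betw_def)
  then have "graph_dist w F u u \<le> ereal (walk_weight w [u])"
    unfolding graph_dist_def by (intro INF_lower) simp
  then show "graph_dist w F u u \<le> 0" by (simp add: walk_weight_def zero_ereal_def)
  show "0 \<le> graph_dist w F u u"
    unfolding graph_dist_def
    by (rule INF_greatest)
      (use assms in \<open>auto simp: walk_betw_def walk_weight_def subset_iff intro!: sum_list_nonneg\<close>)
qed

text \<open>Additional edges only shorten distances. For distance preservers equality survives
  because \<open>F' \<subseteq> E\<close> bounds the distance from below by the one in
  \<open>E\<close>.\<close>

lemma distance_constraint_mono:
  "distance_constraint ty E w F u v \<Longrightarrow> F \<subseteq> F' \<Longrightarrow> F' \<subseteq> E \<Longrightarrow> distance_constraint ty E w F' u v"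
  using graph_dist_antimono[of F F' w u v] graph_dist_antimono[of F' E w u v]
  by (cases ty) auto

text \<open>The constraint on a pair \<open>u\<close>, \<open>u\<close> is not automatic, as an
  additive slack may be negative. But with nonnegative weights the distance from \<open>u\<close> to
  itself is 0 in every subgraph, so the truth of the constraint does not depend on the
  subgraph.\<close>

lemma distance_constraint_refl_cong:
  assumes "\<forall>e\<in>E. 0 \<le> w e" and "F \<subseteq> E" and "F' \<subseteq> E" and "distance_constraint ty E w F u u"
  shows "distance_constraint ty E w F' u u"
proof -
  have "graph_dist w F' u u = graph_dist w F u u"
    using assms graph_dist_refl[of F w u] graph_dist_refl[of F' w u] by (simp add: subset_iff)
  with assms(4) show ?thesis by (cases ty) auto
qed


section \<open>Rounding to powers of two\<close>

lemma round_up_le_iff: "0 < n \<Longrightarrow> round_up n \<le> 2 ^ q \<longleftrightarrow> n \<le> 2 ^ q"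
proof -
  assume "0 < n"
  have "n \<le> 2 ^ (LEAST q. n \<le> 2 ^ q)"
    by (rule LeastI[of _ n]) (simp add: less_imp_le less_exp)
  moreover have "n \<le> 2 ^ q \<Longrightarrow> (LEAST q. n \<le> 2 ^ q) \<le> q" by (rule Least_le)
  ultimately show ?thesis using \<open>0 < n\<close>
    by (auto simp: round_up_def intro: order_trans)
qed

lemma round_up_power: "0 < n \<Longrightarrow> round_up n = 2 ^ (LEAST q. n \<le> 2 ^ q)"
  by (simp add: round_up_def)

lemma le_round_up: "n \<le> round_up n"
proof (cases "n = 0")
  case False
  then show ?thesis using round_up_le_iff round_up_power by (metis order_refl neq0_conv)
qed simp

text \<open>Among powers of two, being at least \<open>2 ^ q\<close> means exceeding the previous
  power \<open>2 ^ (q - 1)\<close>, and whether \<open>round_up n\<close> exceeds it is decided by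
  \<open>n\<close>. Truncated division also covers \<open>q = 0\<close>, where
  \<open>1 div 2 = 0\<close>.\<close>

lemma power_le_round_up_iff: "2 ^ q \<le> round_up n \<longleftrightarrow> 2 ^ q div 2 < n"
proof (cases "n = 0")
  case False
  then have n: "0 < n" by simp
  obtain m where m: "round_up n = 2 ^ m" using round_up_power n by blast
  show ?thesis
  proof (cases q)
    case 0
    then show ?thesis using n m by simp
  next
    case (Suc r)
    have "(2::nat) ^ q \<le> round_up n \<longleftrightarrow> \<not> round_up n \<le> 2 ^ r"
      using m Suc by (simp add: power_increasing_iff Suc_le_eq not_le del: power_Suc)
    then show ?thesis using round_up_le_iff[OF n] Suc by (simp add: not_le)
  qed
qed (simp add: round_up_def)

text \<open>If \<open>2 ^ m\<close> is the largest element, the geometric sum is below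
  \<open>2 * 2 ^ m\<close>, and \<open>2 ^ m div 2 < r\<close> gives \<open>2 ^ m < 2 * r\<close>.
  This is the source of the approximation factor 4.\<close>

lemma sum_powers_of_two_le:
  assumes "finite A" and "\<forall>j\<in>A. \<exists>q. j = (2::nat) ^ q" and "\<forall>j\<in>A. j div 2 < r"
  shows "\<Sum>A \<le> 4 * r"
proof (cases "A = {}")
  case False
  obtain m where m: "Max A = 2 ^ m" using assms(1,2) False Max_in by blast
  have "A \<subseteq> (\<lambda>q. 2 ^ q) ` {..<Suc m}"
  proof
    fix j assume j: "j \<in> A"
    then obtain q where q: "j = 2 ^ q" using assms(2) by blast
    have "j \<le> 2 ^ m" using m Max_ge[OF assms(1) j] by simp
    then have "q < Suc m" using q by (simp add: power_increasing_iff)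
    then show "j \<in> (\<lambda>q. 2 ^ q) ` {..<Suc m}" using q by auto
  qed
  then have "\<Sum>A \<le> \<Sum>((\<lambda>q. 2 ^ q) ` {..<Suc m})" by (intro sum_mono2) auto
  also have "\<dots> = (\<Sum>q<Suc m. 2 ^ q)" by (subst sum.reindex) (auto simp: inj_on_def)
  also have "\<dots> \<le> 2 * 2 ^ m" by (induction m) auto
  also have "\<dots> \<le> 4 * r"
  proof -
    have "(2::nat) ^ m div 2 < r" using m assms(1,3) False Max_in by metis
    then show ?thesis by linarith
  qed
  finally show ?thesis .
qed simp


section \<open>Runs of the algorithm\<close>

locale solved_priority_instance =
  fixes V :: "'a set" and E :: "'a set set" and w :: "'a set \<Rightarrow> real"
    and k :: nat and \<pi> :: "'a \<Rightarrow> nat"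
    and ty :: sparsification_type and mode :: partition_mode
    and slv :: "'a query \<Rightarrow> 'a set set"
    and OPT :: "'a set set" and R_OPT :: "'a set \<Rightarrow> nat"
  assumes graph: "ugraph V E"
    and w_nonneg: "\<forall>e\<in>E. 0 \<le> w e"
    and k_pos: "1 \<le> k"
    and priority_le: "\<forall>v\<in>V. \<pi> v \<le> k"
    and solver: "min_weight_solver ty mode V E w slv"
    and opt: "priority_sparsification ty V E w k \<pi> OPT R_OPT"
begin

abbreviation "L \<equiv> levels mode V \<pi>"

abbreviation "answer i \<equiv> slv (part mode V \<pi> i)"

definition rounded_terminals :: "nat \<Rightarrow> 'a set" where
  "rounded_terminals i = {v \<in> V. i \<le> round_up (\<pi> v)}"

text \<open>For a power of two \<open>j\<close>, \<open>j div 2 + 1\<close> is the least priority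
  that is rounded up to \<open>j\<close> or more.\<close>

definition opt_above :: "nat \<Rightarrow> 'a set set" where
  "opt_above j = {e \<in> OPT. j div 2 < R_OPT e}"

section \<open>Levels and their terminals\<close>

lemma finite_V: "finite V"
  using graph by (simp add: ugraph_def)

lemma finite_E: "finite E"
proof (rule finite_subset)
  show "E \<subseteq> Pow V" using graph by (auto simp: ugraph_def)
qed (simp add: finite_V)

lemma finite_L: "finite L"
  by (rule finite_subset[of _ "(\<lambda>v. round_up (\<pi> v)) ` V"]) (auto simp: levels_def finite_V)

lemma opt_subset: "OPT \<subseteq> E"
  using opt by (simp add: priority_sparsification_def)

lemma level_witness:
  assumes "j \<in> L"
  obtains v where "v \<in> V" and "j = round_up (\<pi> v)" and "0 < \<pi> v"
  using assms by (auto simp: levels_def round_up_def split: if_splits)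

lemma level_power: "j \<in> L \<Longrightarrow> \<exists>q. j = 2 ^ q"
  by (metis level_witness round_up_power)

lemma level_pos: "j \<in> L \<Longrightarrow> 0 < j"
  by (auto simp: levels_def)

lemma rounded_terminals_nonempty: "j \<in> L \<Longrightarrow> rounded_terminals j \<noteq> {}"
  using level_witness[of j] by (auto simp: rounded_terminals_def)

lemma level_le_round_up_iff: "j \<in> L \<Longrightarrow> j \<le> round_up n \<longleftrightarrow> j div 2 < n"
  using level_power[of j] power_le_round_up_iff by auto

lemma rounded_terminals_eq:
  "j \<in> L \<Longrightarrow> rounded_terminals j = terminals V \<pi> (Suc (j div 2))"
  by (simp add: rounded_terminals_def terminals_def level_le_round_up_iff Suc_le_eq)

section \<open>Feasibility of the queries and quality of the answers\<close>

lemma opt_above_sparsification: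
  assumes "j \<in> L"
  shows "opt_above j \<in> sparsifications ty E w (rounded_terminals j)"
proof -
  \<comment> \<open>A level may exceed \<open>k\<close>, but the threshold
    \<open>Suc (j div 2)\<close> does not: the vertex that causes the level has a priority above
    \<open>j div 2\<close> and at most \<open>k\<close>.\<close>
  obtain v where v: "v \<in> V" "j = round_up (\<pi> v)" using level_witness[OF assms] by blast
  then have "j div 2 < \<pi> v" using level_le_round_up_iff[OF assms, of "\<pi> v"] by simp
  then have "Suc (j div 2) \<in> {1..k}" using priority_le v(1) by fastforce
  then have "{e \<in> OPT. Suc (j div 2) \<le> R_OPT e} \<in> sparsifications ty E w (terminals V \<pi> (Suc (j div 2)))"
    using opt unfolding priority_sparsification_def by blast
  then show ?thesis by (simp add: opt_above_def rounded_terminals_eq[OF assms] Suc_le_eq)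
qed

text \<open>The minimum over a pair is attained at one of its ends, so a nonempty block always sits
  at a rounded priority that occurs.\<close>

lemma level_iff_pairs:
  assumes "mode = Pairwise"
  shows "j \<in> L \<longleftrightarrow> 0 < j \<and> (\<exists>u\<in>V. \<exists>v\<in>V. u \<noteq> v \<and> min (round_up (\<pi> u)) (round_up (\<pi> v)) = j)"
  using assms by (auto simp: levels_def min_def split: if_splits)

text \<open>Some pair of the block has an end \<open>s\<close> of rounded priority exactly
  \<open>j\<close>. Every other vertex of rounded priority at least \<open>j\<close> forms a pair of
  the block with \<open>s\<close>, and \<open>s\<close> does so with its partner \<open>t\<close>.
  Thus both modes connect the same terminals.\<close>

lemma Union_pairs:
  assumes "mode = Pairwise" and "j \<in> L" and "part mode V \<pi> j = Pairs P"
  shows "\<Union>P = rounded_terminals j"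
proof (intro equalityI subsetI)
  fix x assume "x \<in> \<Union>P"
  then show "x \<in> rounded_terminals j" using assms by (auto simp: rounded_terminals_def)
next
  fix x assume "x \<in> rounded_terminals j"
  then have x: "x \<in> V" "j \<le> round_up (\<pi> x)" by (auto simp: rounded_terminals_def)
  obtain u v where "u \<in> V" "v \<in> V" "u \<noteq> v" "min (round_up (\<pi> u)) (round_up (\<pi> v)) = j"
    using assms level_iff_pairs by blast
  then obtain s t where st: "s \<in> V" "t \<in> V" "s \<noteq> t" "round_up (\<pi> s) = j" "j \<le> round_up (\<pi> t)"
    by (metis min.cobounded1 min.cobounded2 min_def)
  have "\<exists>y\<in>V. x \<noteq> y \<and> min (round_up (\<pi> x)) (round_up (\<pi> y)) = j"
  proof (cases "x = s")
    case True
    then show ?thesis using st by (intro bexI[of _ t]) simp_all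
  next
    case False
    then show ?thesis using st x by (intro bexI[of _ s]) simp_all
  qed
  then obtain y where "y \<in> V" "x \<noteq> y" "min (round_up (\<pi> x)) (round_up (\<pi> y)) = j" by blast
  then have "{x, y} \<in> P" using assms x by auto
  then show "x \<in> \<Union>P" by blast
qed

lemma part_admissible: "part mode V \<pi> j \<in> admissible_queries mode V"
  by (cases mode) auto

text \<open>Shows that the query is feasible, without which the solver promises nothing, and
  supplies the competitor for its answer.\<close>

lemma opt_above_solution:
  assumes "j \<in> L"
  shows "opt_above j \<in> solutions ty E w (part mode V \<pi> j)"
proof (cases mode)
  case Inclusive
  then show ?thesis using opt_above_sparsification[OF assms] by (simp add: rounded_terminals_def)
next
  case Pairwise
  obtain P where P: "part mode V \<pi> j = Pairs P" using Pairwise by simp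
  have U: "\<Union>P = rounded_terminals j" by (rule Union_pairs[OF Pairwise assms P])
  then have "u \<in> rounded_terminals j \<and> v \<in> rounded_terminals j" if "{u, v} \<in> P" for u v
    using that by blast
  then show ?thesis
    using opt_above_sparsification[OF assms] P U
    by (auto simp: sparsifications_def pair_sparsifications_def)
qed

lemma answer_solution:
  assumes "j \<in> L"
  shows "answer j \<in> solutions ty E w (part mode V \<pi> j)"
    and "edge_weight w (answer j) \<le> edge_weight w (opt_above j)"
  using solver part_admissible opt_above_solution[OF assms]
  unfolding min_weight_solver_def by blast+

text \<open>The consequences that both modes share. Distance constraints depend on the mode and are
  treated in \<open>merged_distance\<close>.\<close>

lemma answer_properties:
  assumes "j \<in> L"
  shows "answer j \<subseteq> E" and "joined (answer j) (rounded_terminals j)"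
    and "ty = Steiner_Tree \<Longrightarrow> tree_spanning (answer j) (rounded_terminals j)"
proof -
  have "answer j \<subseteq> E \<and> joined (answer j) (rounded_terminals j) \<and>
    (ty = Steiner_Tree \<longrightarrow> tree_spanning (answer j) (rounded_terminals j))"
  proof (cases mode)
    case Inclusive
    then show ?thesis using answer_solution(1)[OF assms]
      by (simp add: sparsifications_def rounded_terminals_def)
  next
    case Pairwise
    obtain P where P: "part mode V \<pi> j = Pairs P" using Pairwise by simp
    then show ?thesis using answer_solution(1)[OF assms] Union_pairs[OF Pairwise assms P]
      by (simp add: pair_sparsifications_def)
  qed
  then show "answer j \<subseteq> E" "joined (answer j) (rounded_terminals j)"
    "ty = Steiner_Tree \<Longrightarrow> tree_spanning (answer j) (rounded_terminals j)" by auto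
qed

section \<open>Number of queries and existence of runs\<close>

lemma card_levels: "int (card L) \<le> \<lceil>log 2 (real k)\<rceil> + 1"
proof -
  define Q where "Q = nat \<lceil>log 2 (real k)\<rceil>"
  have c0: "0 \<le> \<lceil>log 2 (real k)\<rceil>"
  proof -
    have "0 \<le> log 2 (real k)" using k_pos by simp
    then show ?thesis by linarith
  qed
  have "log 2 (real k) \<le> real Q" using c0 by (simp add: Q_def)
  then have "real k \<le> 2 powr real Q" using k_pos by (simp add: log_le_iff)
  then have "real k \<le> 2 ^ Q" by (simp add: powr_realpow)
  then have "k \<le> 2 ^ Q" by (metis of_nat_le_iff of_nat_numeral of_nat_power)
  \<comment> \<open>Priorities are at most \<open>k \<le> 2 ^ Q\<close>, and rounding up does not
    pass the power \<open>2 ^ Q\<close>. So only the \<open>Q + 1\<close> powers up to it can be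
    levels.\<close>
  have "L \<subseteq> (\<lambda>q. 2 ^ q) ` {..Q}"
  proof
    fix j assume "j \<in> L"
    then obtain v where v: "v \<in> V" "j = round_up (\<pi> v)" "0 < \<pi> v" by (rule level_witness)
    have "\<pi> v \<le> 2 ^ Q" using priority_le v(1) \<open>k \<le> 2 ^ Q\<close> order_trans by blast
    then have "j \<le> 2 ^ Q" using round_up_le_iff v by simp
    moreover obtain q where "j = 2 ^ q" using level_power \<open>j \<in> L\<close> by blast
    ultimately show "j \<in> (\<lambda>q. 2 ^ q) ` {..Q}" by (simp add: power_increasing_iff)
  qed
  then have "card L \<le> card ((\<lambda>q. (2::nat) ^ q) ` {..Q})" by (intro card_mono) auto
  also have "\<dots> \<le> card {..Q}" by (rule card_image_le) simp
  finally have "card L \<le> Suc Q" by simp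
  then show ?thesis using c0 unfolding Q_def by linarith
qed

text \<open>\<open>M i\<close> depends on the \<open>M j\<close> of higher levels, so
  \<open>M\<close> is chosen by well-founded recursion from the highest level down. Only the pruned
  case needs an argument: the edges kept from above must be acyclic.\<close>

lemma merges_exist:
  "\<exists>M. \<forall>i\<in>L. merge_result ty (answer i) (\<Union>j\<in>{j\<in>L. i < j}. M j) (M i)"
proof -
  let ?R = "{(y, x). y \<in> L \<and> x \<in> L \<and> x < y}"
  let ?P = "\<lambda>M i r. i \<in> L \<longrightarrow> merge_result ty (answer i) (\<Union>j\<in>{j\<in>L. i < j}. M j) r"
  have "\<exists>M. \<forall>i. ?P M i (M i)"
  proof (rule dependent_wf_choice)
    show "wf ?R"
      by (rule wf_subset[OF wf_measure[of "\<lambda>i. Suc (Max L) - i"]])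
        (use finite_L in \<open>auto simp: less_Suc_eq_le diff_less_mono2\<close>)
  next
    fix f g :: "nat \<Rightarrow> 'a set set" and x r
    assume "\<And>z. (z, x) \<in> ?R \<Longrightarrow> f z = g z"
    then have "x \<in> L \<Longrightarrow> (\<Union>j\<in>{j\<in>L. x < j}. f j) = (\<Union>j\<in>{j\<in>L. x < j}. g j)"
      by (intro SUP_cong) auto
    then show "?P f x r = ?P g x r" by auto
  next
    fix i and M :: "nat \<Rightarrow> 'a set set"
    assume "\<And>y. (y, i) \<in> ?R \<Longrightarrow> ?P M y (M y)"
    then have M: "merge_result ty (answer j) (\<Union>m\<in>{m\<in>L. j < m}. M m) (M j)"
      if "i \<in> L" "j \<in> L" "i < j" for j
      using that by blast
    define K where "K = (\<Union>j\<in>{j\<in>L. i < j}. M j)"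
    have "\<exists>r. merge_result ty (answer i) K r" if i: "i \<in> L"
    proof (cases "ty = Steiner_Tree")
      case True
      \<comment> \<open>Needed for finiteness of the graph to be pruned; the induction descends from
        the highest level.\<close>
      have sub: "M j \<subseteq> E" if "j \<in> L" "i < j" for j
        using that
      proof (induction "Suc (Max L) - j" arbitrary: j rule: less_induct)
        case less
        have "M m \<subseteq> E" if "m \<in> L" "j < m" for m
        proof -
          have "m \<le> Max L" using Max_ge[OF finite_L that(1)] .
          then have "Suc (Max L) - m < Suc (Max L) - j" using that(2) by linarith
          then show ?thesis using less.hyps less.prems(2) that by (meson less_trans)
        qed
        then show ?case
          using merge_result_subset[OF M[OF i less.prems]] answer_properties(1)[OF less.prems(1)]
          by blast
      qed
      have "acyclic_edges K"
      proof (cases "{j\<in>L. i < j} = {}")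
        case True
        then show ?thesis by (simp add: K_def acyclic_edges_empty del: Collect_empty_eq)
      next
        case False
        \<comment> \<open>The merged solutions are nested, so \<open>K\<close> is the one of the
          next level \<open>m\<close> above \<open>i\<close>, and that one was pruned to be
          acyclic.\<close>
        define m where "m = Min {j\<in>L. i < j}"
        have fin: "finite {j\<in>L. i < j}" using finite_L by simp
        have m: "m \<in> L" "i < m" using Min_in[OF fin False] by (auto simp: m_def)
        have "M j \<subseteq> M m" if "j \<in> L" "i < j" for j
        proof (cases "j = m")
          case False
          then have "m < j" using Min_le[OF fin, of j] that by (simp add: m_def)
          then show ?thesis using merge_result_subset[OF M[OF i m]] that by blast
        qed simp
        then have "K = M m" using m by (auto simp: K_def)
        then show ?thesis using M[OF i m] \<open>ty = Steiner_Tree\<close> by (simp add: merge_result_def)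
      qed
      moreover have "finite (answer i \<union> K)"
        using finite_subset[OF _ finite_E, of "answer i \<union> K"] sub answer_properties(1)[OF i]
        by (auto simp: K_def)
      ultimately show ?thesis
        using prune_to_acyclic[of "answer i \<union> K" K] True by (simp add: merge_result_def)
    qed (auto simp: merge_result_def)
    then show "\<exists>r. ?P M i r" by (auto simp: K_def)
  qed
  then show ?thesis by blast
qed

lemma run_exists: "\<exists>qs H R. priority_run ty mode V k \<pi> slv qs H R"
  using merges_exist unfolding priority_run_def Let_def by blast

end

section \<open>Merged solutions are sparsifications\<close>

locale merged_run = solved_priority_instance +
  fixes M :: "nat \<Rightarrow> 'a set set"
  assumes merges: "\<forall>i\<in>L. merge_result ty (answer i) (\<Union>j\<in>{j\<in>L. i < j}. M j) (M i)"
begin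

lemma merged_bounds:
  assumes "i \<in> L"
  shows "(\<Union>j\<in>{j\<in>L. i < j}. M j) \<subseteq> M i" and "M i \<subseteq> answer i \<union> (\<Union>j\<in>{j\<in>L. i < j}. M j)"
  using merge_result_subset[OF bspec[OF merges assms]] by blast+

lemma merged_antimono: "i \<in> L \<Longrightarrow> j \<in> L \<Longrightarrow> i \<le> j \<Longrightarrow> M j \<subseteq> M i"
  using merged_bounds(1)[of i] by (cases "i = j") (auto simp: le_less)

lemma merged_cases: "i \<in> L \<Longrightarrow> e \<in> M i \<Longrightarrow> e \<in> answer i \<or> (\<exists>j\<in>L. i < j \<and> e \<in> M j)"
  using merged_bounds(2)[of i] by blast

text \<open>At the highest level that contains \<open>e\<close>, the edge cannot have been inherited
  from above.\<close>

lemma merged_in_answer: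
  assumes i: "i \<in> L" "e \<in> M i"
  shows "\<exists>j\<in>L. i \<le> j \<and> e \<in> answer j"
proof -
  define j where "j = Max {j\<in>L. e \<in> M j}"
  have fin: "finite {j\<in>L. e \<in> M j}" using finite_L by simp
  have j: "j \<in> L" "e \<in> M j" using Max_in[OF fin] i by (auto simp: j_def)
  have max: "m \<le> j" if "m \<in> L" "e \<in> M m" for m
    using Max_ge[OF fin, of m] that by (simp add: j_def)
  with j i show ?thesis using merged_cases[OF j] by (meson not_le)
qed

lemma merged_subset: "i \<in> L \<Longrightarrow> M i \<subseteq> E"
  using merged_in_answer answer_properties(1) by blast

text \<open>Pruning may delete edges of the answer itself, so inclusion can fail for Steiner trees;
  reachability survives.\<close>

lemma answer_reachable_merged:
  assumes "i \<in> L" and "(adjacent (answer i))\<^sup>*\<^sup>* u v"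
  shows "(adjacent (M i))\<^sup>*\<^sup>* u v"
  using merges assms(1) adjacent_rtranclp_mono[OF _ assms(2), of "answer i \<union> (\<Union>j\<in>{j\<in>L. i < j}. M j)"]
  by (blast intro: merge_result_reachable)

lemma merged_joined: "i \<in> L \<Longrightarrow> joined (M i) (rounded_terminals i)"
  using answer_properties(2) answer_reachable_merged by (auto simp: joined_iff_rtranclp)

text \<open>Connectedness must reach all vertices of \<open>M i\<close>, not only its terminals.
  Each of its edges stems from the answer of some level \<open>j \<ge> i\<close>, a tree that links
  it to a terminal of level \<open>j\<close>, which is also a terminal of level
  \<open>i\<close>.\<close>

lemma merged_tree:
  assumes "ty = Steiner_Tree" and i: "i \<in> L"
  shows "tree_spanning (M i) (rounded_terminals i)"
proof -
  have acyc: "acyclic_edges (M i)" using merges assms by (auto simp: merge_result_def)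
  have hook: "\<exists>t\<in>rounded_terminals i. (adjacent (M i))\<^sup>*\<^sup>* x t" if "x \<in> \<Union>(M i)" for x
  proof -
    from that obtain e where e: "e \<in> M i" "x \<in> e" by blast
    obtain j where j: "j \<in> L" "i \<le> j" "e \<in> answer j" using merged_in_answer[OF i e(1)] by blast
    obtain t where t: "t \<in> rounded_terminals j" using rounded_terminals_nonempty[OF j(1)] by blast
    have "(adjacent (answer j))\<^sup>*\<^sup>* x t"
      using answer_properties(3)[OF j(1) assms(1)] e(2) j(3) t
      unfolding tree_spanning_def joined_iff_rtranclp by blast
    then have "(adjacent (M i))\<^sup>*\<^sup>* x t"
      using answer_reachable_merged[OF j(1)] adjacent_rtranclp_mono[OF merged_antimono[OF i j(1,2)]]
      by blast
    moreover have "t \<in> rounded_terminals i" using t j(2) by (auto simp: rounded_terminals_def)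
    ultimately show ?thesis by blast
  qed
  then have hook': "\<exists>t\<in>rounded_terminals i. (adjacent (M i))\<^sup>*\<^sup>* x t"
    if "x \<in> rounded_terminals i \<union> \<Union>(M i)" for x
    using that by blast
  have "joined (M i) (rounded_terminals i \<union> \<Union>(M i))"
    unfolding joined_iff_rtranclp
  proof (intro ballI)
    fix x y assume "x \<in> rounded_terminals i \<union> \<Union>(M i)" "y \<in> rounded_terminals i \<union> \<Union>(M i)"
    then obtain s t where "s \<in> rounded_terminals i" "(adjacent (M i))\<^sup>*\<^sup>* x s"
      "t \<in> rounded_terminals i" "(adjacent (M i))\<^sup>*\<^sup>* y t" using hook' by meson
    then show "(adjacent (M i))\<^sup>*\<^sup>* x y"
      using merged_joined[OF i] adjacent_rtranclp_sym unfolding joined_iff_rtranclp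
      by (meson rtranclp_trans)
  qed
  with acyc show ?thesis by (simp add: tree_spanning_def)
qed

text \<open>Inherited from \<open>OPT\<close>, in which \<open>v\<close> is a terminal of level 1.
  Pairwise queries never demand a pair \<open>v\<close>, \<open>v\<close>, so the answers cannot
  provide this.\<close>

lemma distance_constraint_refl:
  assumes "F \<subseteq> E" and "v \<in> V" and "0 < \<pi> v"
  shows "distance_constraint ty E w F v v"
proof -
  have "1 \<in> {1..k}" using k_pos by simp
  then have *: "{e \<in> OPT. 1 \<le> R_OPT e} \<in> sparsifications ty E w (terminals V \<pi> 1)"
    using opt unfolding priority_sparsification_def by blast
  have "v \<in> terminals V \<pi> 1" using assms by (simp add: terminals_def)
  with * have "distance_constraint ty E w {e \<in> OPT. 1 \<le> R_OPT e} v v"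
    by (auto simp: sparsifications_def)
  then show ?thesis
    by (rule distance_constraint_refl_cong[OF w_nonneg _ assms(1), rotated]) (use opt_subset in auto)
qed

text \<open>Outside the Steiner tree case merging is a plain union, so answers persist downwards. In
  the pairwise mode the pair \<open>u\<close>, \<open>v\<close> is served by the answer of its own
  level \<open>m \<ge> i\<close>, which is contained in \<open>M i\<close>.\<close>

lemma merged_distance:
  assumes i: "i \<in> L" and u: "u \<in> rounded_terminals i" and v: "v \<in> rounded_terminals i"
  shows "distance_constraint ty E w (M i) u v"
proof (cases "ty = Steiner_Tree")
  case False
  then have sub: "answer j \<subseteq> M j" if "j \<in> L" for j
    using merges that by (auto simp: merge_result_def)
  show ?thesis
  proof (cases mode)
    case Inclusive
    then have "distance_constraint ty E w (answer i) u v"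
      using answer_solution(1)[OF i] u v by (simp add: sparsifications_def rounded_terminals_def)
    then show ?thesis by (rule distance_constraint_mono[OF _ sub[OF i] merged_subset[OF i]])
  next
    case Pairwise
    show ?thesis
    proof (cases "u = v")
      case True
      have "0 < \<pi> u" using u level_pos[OF i]
        by (auto simp: rounded_terminals_def round_up_def split: if_splits)
      then show ?thesis using True distance_constraint_refl merged_subset[OF i] u
        by (simp add: rounded_terminals_def)
    next
      case False
      define m where "m = min (round_up (\<pi> u)) (round_up (\<pi> v))"
      have uv: "u \<in> V" "v \<in> V" "i \<le> m" using u v by (auto simp: rounded_terminals_def m_def)
      have m: "m \<in> L" unfolding level_iff_pairs[OF Pairwise]
        using uv False level_pos[OF i] by (auto simp: m_def)
      obtain P where P: "part mode V \<pi> m = Pairs P" using Pairwise by simp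
      have "{u, v} \<in> P" using P Pairwise uv False by (auto simp: m_def)
      then have "distance_constraint ty E w (answer m) u v"
        using answer_solution(1)[OF m] P by (simp add: pair_sparsifications_def)
      then show ?thesis
        by (rule distance_constraint_mono[OF _
              order_trans[OF sub[OF m] merged_antimono[OF i m uv(3)]] merged_subset[OF i]])
    qed
  qed
qed simp

lemma merged_sparsification:
  assumes "i \<in> L" and "T \<subseteq> rounded_terminals i"
  shows "M i \<in> sparsifications ty E w T"
proof -
  note i = assms(1) and T = assms(2)
  have "joined (M i) T" by (rule joined_mono[OF merged_joined[OF i] order_refl T])
  moreover have "ty = Steiner_Tree \<longrightarrow> tree_spanning (M i) T"
    using tree_spanning_mono[OF merged_tree[OF _ i] T] by blast
  ultimately show ?thesis
    using merged_subset[OF i] merged_distance[OF i] T by (auto simp: sparsifications_def)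
qed

section \<open>Rates and validity of the output\<close>

definition H where "H = (\<Union>i\<in>L. M i)"

definition R where "R = (\<lambda>e. Max {i \<in> {1..k}. \<exists>j\<in>L. i \<le> j \<and> e \<in> M j})"

lemma rate:
  assumes "e \<in> H"
  shows "R e \<in> {1..k}" and "\<exists>j\<in>L. R e \<le> j \<and> e \<in> M j"
    and "i \<in> {1..k} \<Longrightarrow> i \<le> R e \<longleftrightarrow> (\<exists>j\<in>L. i \<le> j \<and> e \<in> M j)"
proof -
  let ?S = "{i \<in> {1..k}. \<exists>j\<in>L. i \<le> j \<and> e \<in> M j}"
  have fin: "finite ?S" by simp
  obtain j where "j \<in> L" "e \<in> M j" using assms by (auto simp: H_def)
  moreover from this have "1 \<le> j" using level_pos[of j] by simp
  \<comment> \<open>Ensures that \<open>R e\<close> is a maximum over a nonempty set.\<close>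
  ultimately have "1 \<in> ?S" using k_pos by auto
  then have S: "R e \<in> ?S" unfolding R_def using Max_in[OF fin] by blast
  then show "R e \<in> {1..k}" and *: "\<exists>j\<in>L. R e \<le> j \<and> e \<in> M j" by blast+
  assume i: "i \<in> {1..k}"
  show "i \<le> R e \<longleftrightarrow> (\<exists>j\<in>L. i \<le> j \<and> e \<in> M j)"
  proof
    show "i \<le> R e \<Longrightarrow> \<exists>j\<in>L. i \<le> j \<and> e \<in> M j" using * order_trans by blast
    show "\<exists>j\<in>L. i \<le> j \<and> e \<in> M j \<Longrightarrow> i \<le> R e" unfolding R_def using i by (intro Max_ge fin) auto
  qed
qed

lemma rate_ge_sparsification:
  assumes i: "i \<in> {1..k}"
  shows "{e \<in> H. i \<le> R e} \<in> sparsifications ty E w (terminals V \<pi> i)"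
proof -
  have eq: "{e \<in> H. i \<le> R e} = (\<Union>j\<in>{j\<in>L. i \<le> j}. M j)"
    using rate(3)[OF _ i] by (auto simp: H_def)
  have term_round: "i \<le> round_up (\<pi> v)" "0 < \<pi> v" if "v \<in> terminals V \<pi> i" for v
    using that i le_round_up[of "\<pi> v"] by (auto simp: terminals_def)
  show ?thesis
  proof (cases "{j\<in>L. i \<le> j} = {}")
    \<comment> \<open>Without a level from \<open>i\<close> upwards at most one terminal remains:
      two of them would yield a level in either mode. The empty edge set then suffices.\<close>
    case True
    have single: "u = v" if u: "u \<in> terminals V \<pi> i" and v: "v \<in> terminals V \<pi> i" for u v
    proof (rule ccontr)
      assume "u \<noteq> v"
      then have "\<exists>j\<in>L. i \<le> j"
      proof (cases mode)
        case Inclusive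
        then have "round_up (\<pi> u) \<in> L"
          using u term_round[OF u] i by (auto simp: levels_def terminals_def)
        then show ?thesis using term_round[OF u] by blast
      next
        case Pairwise
        have "min (round_up (\<pi> u)) (round_up (\<pi> v)) \<in> L"
          unfolding level_iff_pairs[OF Pairwise]
          using u v \<open>u \<noteq> v\<close> term_round[OF u] term_round[OF v] i by (auto simp: terminals_def)
        then show ?thesis using term_round[OF u] term_round[OF v] by (metis min.boundedI)
      qed
      then show False using True by blast
    qed
    have "joined {} (terminals V \<pi> i)" unfolding joined_iff_rtranclp using single by blast
    moreover have "distance_constraint ty E w {} u v"
      if "u \<in> terminals V \<pi> i" "v \<in> terminals V \<pi> i" for u v
      using single[OF that] distance_constraint_refl[of "{}" v] term_round that
      by (auto simp: terminals_def)
    ultimately show ?thesis unfolding eq True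
      by (simp add: sparsifications_def tree_spanning_def acyclic_edges_empty)
  next
    case False
    \<comment> \<open>By nesting, the edges of rate at least \<open>i\<close> are exactly those of
      \<open>M m\<close>. It remains to see that no terminal of priority at least \<open>i\<close>
      is lost between \<open>i\<close> and \<open>m\<close>.\<close>
    define m where "m = Min {j\<in>L. i \<le> j}"
    have fin: "finite {j\<in>L. i \<le> j}" using finite_L by simp
    have m: "m \<in> L" "i \<le> m" using Min_in[OF fin False] by (auto simp: m_def)
    have min: "m \<le> j" if "j \<in> L" "i \<le> j" for j using Min_le[OF fin, of j] that by (simp add: m_def)
    have "(\<Union>j\<in>{j\<in>L. i \<le> j}. M j) = M m" using m min merged_antimono[OF m(1)] by blast
    moreover have "terminals V \<pi> i \<subseteq> rounded_terminals m"
    proof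
      fix v assume v: "v \<in> terminals V \<pi> i"
      then have vV: "v \<in> V" by (simp add: terminals_def)
      have "m \<le> round_up (\<pi> v)"
      proof (rule ccontr)
        assume less: "\<not> m \<le> round_up (\<pi> v)"
        obtain u where u: "u \<in> V" "m = round_up (\<pi> u)" using level_witness[OF m(1)] by blast
        \<comment> \<open>A lost terminal \<open>v\<close> would itself cause a level from
          \<open>i\<close> upwards and below \<open>m\<close>, against minimality. In the pairwise
          mode its partner is \<open>u\<close>, whose rounded priority \<open>m\<close> is
          larger.\<close>
        have "round_up (\<pi> v) \<in> L"
        proof (cases mode)
          case Inclusive
          then show ?thesis using vV term_round[OF v] i by (auto simp: levels_def)
        next
          case Pairwise
          show ?thesis unfolding level_iff_pairs[OF Pairwise]
            using vV u less term_round[OF v] i by (force simp: min_def)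
        qed
        then show False using min term_round[OF v] less by blast
      qed
      then show "v \<in> rounded_terminals m" using vV by (simp add: rounded_terminals_def)
    qed
    ultimately show ?thesis unfolding eq using merged_sparsification[OF m(1)] by simp
  qed
qed

lemma output_subset: "H \<subseteq> E"
  unfolding H_def using merged_subset by blast

lemma run_valid: "priority_sparsification ty V E w k \<pi> H R"
  unfolding priority_sparsification_def
  using output_subset rate(1) rate_ge_sparsification by blast

section \<open>Weight of the output\<close>

lemma run_weight: "priority_weight w H R \<le> 4 * priority_weight w OPT R_OPT"
proof -
  have "priority_weight w H R \<le> (\<Sum>e\<in>H. \<Sum>j\<in>L. if e \<in> answer j then real j * w e else 0)"
    unfolding priority_weight_def
  proof (rule sum_mono)
    fix e assume e: "e \<in> H"
    obtain i where "i \<in> L" "R e \<le> i" "e \<in> M i" using rate(2)[OF e] by blast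
    then obtain j where j: "j \<in> L" "R e \<le> j" "e \<in> answer j"
      using merged_in_answer[of i e] by (meson order_trans)
    have w_e: "0 \<le> w e" using e output_subset w_nonneg by blast
    then have "real (R e) * w e \<le> (if e \<in> answer j then real j * w e else 0)"
      using j by (simp add: mult_right_mono)
    also have "\<dots> \<le> (\<Sum>j\<in>L. if e \<in> answer j then real j * w e else 0)"
      by (rule member_le_sum[OF j(1)]) (use w_e finite_L in auto)
    finally show "real (R e) * w e \<le> (\<Sum>j\<in>L. if e \<in> answer j then real j * w e else 0)" .
  qed
  \<comment> \<open>Passing from \<open>H\<close> to \<open>E\<close> also pays for edges of answers
    that pruning removed, so that each answer is counted in full after swapping the sums.\<close>
  also have "\<dots> \<le> (\<Sum>e\<in>E. \<Sum>j\<in>L. if e \<in> answer j then real j * w e else 0)"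
    by (rule sum_mono2[OF finite_E output_subset]) (use w_nonneg in \<open>auto intro!: sum_nonneg\<close>)
  also have "\<dots> = (\<Sum>j\<in>L. \<Sum>e\<in>E. if e \<in> answer j then real j * w e else 0)" by (rule sum.swap)
  also have "\<dots> = (\<Sum>j\<in>L. real j * edge_weight w (answer j))"
  proof (rule sum.cong)
    fix j assume "j \<in> L"
    then have "E \<inter> answer j = answer j" using answer_properties(1) by blast
    then show "(\<Sum>e\<in>E. if e \<in> answer j then real j * w e else 0) = real j * edge_weight w (answer j)"
      by (simp add: sum.inter_restrict[OF finite_E, symmetric] edge_weight_def sum_distrib_left)
  qed simp
  also have "\<dots> \<le> (\<Sum>j\<in>L. real j * edge_weight w (opt_above j))"
    by (intro sum_mono mult_left_mono answer_solution(2)) auto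
  also have "\<dots> = (\<Sum>j\<in>L. \<Sum>e\<in>OPT. if j div 2 < R_OPT e then real j * w e else 0)"
    by (auto simp: edge_weight_def opt_above_def sum_distrib_left
        sum.inter_filter[OF finite_subset[OF opt_subset finite_E]] intro!: sum.cong)
  also have "\<dots> = (\<Sum>e\<in>OPT. \<Sum>j\<in>L. if j div 2 < R_OPT e then real j * w e else 0)"
    by (rule sum.swap)
  also have "\<dots> = (\<Sum>e\<in>OPT. real (\<Sum>{j\<in>L. j div 2 < R_OPT e}) * w e)"
    by (simp add: sum.inter_filter[OF finite_L, symmetric] sum_distrib_right)
  also have "\<dots> \<le> (\<Sum>e\<in>OPT. real (4 * R_OPT e) * w e)"
  proof (rule sum_mono)
    fix e assume e: "e \<in> OPT"
    have "\<Sum>{j\<in>L. j div 2 < R_OPT e} \<le> 4 * R_OPT e"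
      by (rule sum_powers_of_two_le) (use finite_L level_power in auto)
    then have "real (\<Sum>{j\<in>L. j div 2 < R_OPT e}) \<le> real (4 * R_OPT e)" by (simp only: of_nat_le_iff)
    then show "real (\<Sum>{j\<in>L. j div 2 < R_OPT e}) * w e \<le> real (4 * R_OPT e) * w e"
      using e opt_subset w_nonneg by (intro mult_right_mono) auto
  qed
  also have "\<dots> = 4 * priority_weight w OPT R_OPT"
    by (simp add: priority_weight_def sum_distrib_left mult.assoc)
  finally show ?thesis .
qed

end

text \<open>Existence of a run keeps the second part from being vacuous; the second part covers
  every choice of edges deleted by pruning.\<close>

theorem theorem1:
  fixes V :: "'a set" and E :: "'a set set" and w :: "'a set \<Rightarrow> real"
    and k :: nat and \<pi> :: "'a \<Rightarrow> nat"
    and ty :: sparsification_type and mode :: partition_mode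
    and slv :: "'a query \<Rightarrow> 'a set set"
    and OPT :: "'a set set" and R_OPT :: "'a set \<Rightarrow> nat"
  assumes "ugraph V E"
    and "\<forall>e\<in>E. 0 \<le> w e"
    and "1 \<le> k"
    and "\<forall>v\<in>V. \<pi> v \<le> k"
    and "min_weight_solver ty mode V E w slv"
    and "optimal_priority_sparsification ty V E w k \<pi> OPT R_OPT"
  shows "(\<exists>qs H R. priority_run ty mode V k \<pi> slv qs H R) \<and>
    (\<forall>qs H R. priority_run ty mode V k \<pi> slv qs H R \<longrightarrow>
       int (length qs) \<le> \<lceil>log 2 (real k)\<rceil> + 1 \<and>
       priority_sparsification ty V E w k \<pi> H R \<and>
       priority_weight w H R \<le> 4 * priority_weight w OPT R_OPT)"
proof -
  have inst: "solved_priority_instance V E w k \<pi> ty mode slv OPT R_OPT"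
    using assms by (simp add: solved_priority_instance_def optimal_priority_sparsification_def)
  show ?thesis
  proof (intro conjI allI impI)
    show "\<exists>qs H R. priority_run ty mode V k \<pi> slv qs H R"
      by (rule solved_priority_instance.run_exists[OF inst])
  next
    fix qs H R assume "priority_run ty mode V k \<pi> slv qs H R"
    then obtain M where qs: "qs = map (part mode V \<pi>) (sorted_list_of_set (levels mode V \<pi>))"
      and M: "\<forall>i\<in>levels mode V \<pi>. merge_result ty (slv (part mode V \<pi> i))
        (\<Union>j\<in>{j\<in>levels mode V \<pi>. i < j}. M j) (M i)"
      and H: "H = (\<Union>i\<in>levels mode V \<pi>. M i)"
      and R: "R = (\<lambda>e. Max {i \<in> {1..k}. \<exists>j\<in>levels mode V \<pi>. i \<le> j \<and> e \<in> M j})"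
      unfolding priority_run_def Let_def by blast
    have run: "merged_run V E w k \<pi> ty mode slv OPT R_OPT M"
      using inst M by (simp add: merged_run_def merged_run_axioms_def)
    show "int (length qs) \<le> \<lceil>log 2 (real k)\<rceil> + 1"
      using qs solved_priority_instance.card_levels[OF inst] by simp
    show "priority_sparsification ty V E w k \<pi> H R"
      using merged_run.run_valid[OF run]
      unfolding merged_run.H_def[OF run] merged_run.R_def[OF run] H R .
    show "priority_weight w H R \<le> 4 * priority_weight w OPT R_OPT"
      using merged_run.run_weight[OF run]
      unfolding merged_run.H_def[OF run] merged_run.R_def[OF run] H R .
  qed
qed

end
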